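(* Let $n \in \mathbb{N}$ ($n\ge1$), $a,b,c,d \in \mathbb{R}$, and let $\lambda_1,\dots,\lambda_{n+2}$, $\mathbf{H}_n$, and (according to the parity of $n$) $\mathbf{u},\mathbf{v},\mathbf{R}_n,\mathbf{P}_n$ and the polynomials $f,g$ be as defined in the context. (a) Suppose $n$ is even. i. If $\mu_{1}, \ldots, \mu_{n/2}$ are the zeros of $f$ and $\lambda_{1}, \lambda_{3}, \ldots, \lambda_{n+1}$ are all distinct, then for each $k=1,\ldots,\frac n2$ the vector $$\mathbf{R}_{n} \mathbf{P}_{n}^{\top} \begin{bmatrix} \mathbf{I}_{n/2} + \mathbf{u} \mathbf{u}^{\top} & \mathbf{O} \\ \mathbf{O} & \mathbf{I}_{n/2} + \mathbf{v} \mathbf{v}^{\top}\end{bmatrix}\begin{bmatrix}\mathbf{p}\\ \mathbf{0}\end{bmatrix},\qquad \mathbf{p}\in\mathbb{R}^{n/2},\quad p_j=\frac{\sin\left(\frac{(2j+1)\pi}{n+3} \right)}{(\mu_{k} - \lambda_{2j+1}) \sin \left(\frac{\pi}{n+3} \right)}\ \ (1\le j\le \tfrac n2),$$ is an eigenvector of $\mathbf{H}_{n}$ associated to $\mu_{k}$. ii. If $\nu_{1}, \ldots, \nu_{n/2}$ are the zeros of $g$ and $\lambda_{2}, \lambda_{4}, \ldots, \lambda_{n+2}$ are all distinct, then for each $k=1,\ldots,\frac n2$ the vector $$\mathbf{R}_{n} \mathbf{P}_{n}^{\top} \begin{bmatrix} \mathbf{I}_{n/2} + \mathbf{u} \mathbf{u}^{\top}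 & \mathbf{O} \\ \mathbf{O} & \mathbf{I}_{n/2} + \mathbf{v} \mathbf{v}^{\top}\end{bmatrix}\begin{bmatrix}\mathbf{0}\\ \mathbf{p}\end{bmatrix},\qquad \mathbf{p}\in\mathbb{R}^{n/2},\quad p_j=\frac{\sin\left(\frac{2j\pi}{n+3} \right)}{(\nu_{k} - \lambda_{2j}) \sin \left(\frac{\pi}{n+3} \right)}\ \ (1\le j\le \tfrac n2),$$ is an eigenvector of $\mathbf{H}_{n}$ associated to $\nu_{k}$. (b) Suppose $n$ is odd. i. If $\mu_{1}, \ldots, \mu_{(n+1)/2}$ are the zeros of $f$ and $\lambda_{1}, \lambda_{3}, \ldots, \lambda_{n}, \lambda_{n+2}$ are all distinct, then for each $k=1,\ldots,\frac{n+1}2$ the vector $$\mathbf{R}_{n} \mathbf{P}_{n} \begin{bmatrix} \mathbf{I}_{(n+1)/2} + \mathbf{u} \mathbf{u}^{\top} & \mathbf{O} \\ \mathbf{O} & \mathbf{I}_{(n-1)/2} + \mathbf{v} \mathbf{v}^{\top}\end{bmatrix}\begin{bmatrix}\mathbf{p}\\ \mathbf{0}\end{bmatrix},\qquad \mathbf{p}\in\mathbb{R}^{(n+1)/2},\quad p_j=\frac{\sin\left(\frac{(2j+1)\pi}{n+3} \right)}{(\mu_{k} - \lambda_{2j+1}) \sin \left(\frac{\pi}{n+3} \right)}\ \ (1\le j\le \tfrac{n+1}2)$$ (so that the last component is $p_{(n+1)/2}=\frac{1}{\mu_k-\lambda_{n+2}}$), is an eigenvector of $\mathbf{H}_{n}$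 associated to $\mu_{k}$. ii. If $\nu_{1}, \ldots, \nu_{(n-1)/2}$ are the zeros of $g$ and $\lambda_{2}, \lambda_{4}, \ldots, \lambda_{n+1}$ are all distinct, then for each $k=1,\ldots,\frac{n-1}2$ the vector $$\mathbf{R}_{n} \mathbf{P}_{n} \begin{bmatrix} \mathbf{I}_{(n+1)/2} + \mathbf{u} \mathbf{u}^{\top} & \mathbf{O} \\ \mathbf{O} & \mathbf{I}_{(n-1)/2} + \mathbf{v} \mathbf{v}^{\top}\end{bmatrix}\begin{bmatrix}\mathbf{0}\\ \mathbf{p}\end{bmatrix},\qquad \mathbf{p}\in\mathbb{R}^{(n-1)/2},\quad p_j=\frac{\sin\left(\frac{2j\pi}{n+3} \right)}{(\nu_{k} - \lambda_{2j}) \sin \left(\frac{(n+1)\pi}{n+3} \right)}\ \ (1\le j\le \tfrac{n-1}2),$$ is an eigenvector of $\mathbf{H}_{n}$ associated to $\nu_{k}$.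
   Context: For $n\in\mathbb{N}$ and scalars $a,b,c,d$, $\mathbf{H}_n$ is the $n\times n$ anti-heptadiagonal persymmetric Hankel matrix with entries $[\mathbf{H}_n]_{k,\ell}=d$ if $k+\ell=n+1$; $=c$ if $|k+\ell-n-1|=1$; $=b$ if $|k+\ell-n-1|=2$; $=a$ if $|k+\ell-n-1|=3$; and $=0$ otherwise. For $k=1,2,\ldots,n+2$, $$\lambda_{k} = -2a \cos \left(\tfrac{n k \pi}{n+3} \right) - 2b \cos \left(\tfrac{(n + 1) k \pi}{n+3} \right) - 2c \cos \left(\tfrac{(n + 2) k \pi}{n+3} \right) - d \cos (k \pi).$$ Case $n$ even. $\mathbf{u},\mathbf{v}\in\mathbb{R}^{n/2}$ with $u_j=\frac{\sin((2j+1)\pi/(n+3))}{\sin(\pi/(n+3))}$, $v_j=\frac{\sin(2j\pi/(n+3))}{\sin(\pi/(n+3))}$, $1\le j\le n/2$. $\mathbf{R}_n$ is the $n\times n$ matrix $[\mathbf{R}_n]_{k,\ell}=\sqrt{\frac{2}{n+3}}\sin\left(\frac{(k+1)(\ell+1)\pi}{n+3}\right)$. $\mathbf{P}_n$ is the $n\times n$ permutation matrix with $[\mathbf{P}_n]_{k,\ell}=1$ if $\ell=2k$ or $\ell=2k-n-1$, and $0$ otherwise. The polynomials are $$f(t) = \prod_{j=1}^{n/2} (t - \lambda_{2j+1}) + (t - \lambda_{1}) \sum_{j=1}^{n/2} \frac{\sin^{2} \left(\frac{(2j + 1)\pi}{n + 3} \right)}{\sin^{2} \left(\frac{\pi}{n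 + 3} \right)} \prod_{\substack{m=1 \\ m \neq j}}^{n/2} (t - \lambda_{2m+1}),$$ $$g(t) = \prod_{j=1}^{n/2} (t - \lambda_{2j}) + (t - \lambda_{n+2}) \sum_{j=1}^{n/2} \frac{\sin^{2} \left(\frac{2j\pi}{n + 3} \right)}{\sin^{2} \left(\frac{\pi}{n + 3} \right)} \prod_{\substack{m=1 \\ m \neq j}}^{n/2} (t - \lambda_{2m}).$$ Case $n$ odd. $\mathbf{u}\in\mathbb{R}^{(n+1)/2}$ with $u_j=\frac{\sin((2j+1)\pi/(n+3))}{\sin(\pi/(n+3))}$, $1\le j\le \frac{n+1}2$ (so the last component is $1$), and $\mathbf{v}\in\mathbb{R}^{(n-1)/2}$ with $v_j=\frac{\sin(2j\pi/(n+3))}{\sin((n+1)\pi/(n+3))}$, $1\le j\le\frac{n-1}2$. $\mathbf{R}_n$ is the $n\times n$ matrix with $[\mathbf{R}_n]_{k,\ell}=\sqrt{\frac{2}{n+3}}\sin\left(\frac{(k+1)(\ell+1)\pi}{n+3}\right)$ if $\ell<n$ and $[\mathbf{R}_n]_{k,n}=\sqrt{\frac{2}{n+3}}\sin\left(\frac{(k+1)(n+2)\pi}{n+3}\right)$. $\mathbf{P}_n$ is the $n\times n$ permutation matrix with $[\mathbf{P}_n]_{k,\ell}=1$ if $k=2\ell$, or $k=2\ell-n-2$, or ($k=n$ and $\ell=\frac{n+1}2$), and $0$ otherwise. The polynomials are $$f(t) = \prod_{j=1}^{(n+1)/2} (t - \lambda_{2j+1}) + (t - \lambda_{1}) \sum_{j=1}^{(n+1)/2}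 \frac{\sin^{2} \left(\frac{(2j + 1)\pi}{n + 3} \right)}{\sin^{2} \left(\frac{\pi}{n + 3} \right)} \prod_{\substack{m=1 \\ m \neq j}}^{(n+1)/2}(t - \lambda_{2m+1}),$$ $$g(t) = \prod_{j=1}^{(n-1)/2}(t - \lambda_{2j}) + (t - \lambda_{n+1}) \sum_{j=1}^{(n-1)/2} \frac{\sin^{2} \left(\frac{2j\pi}{n + 3} \right)}{\sin^{2} \left(\frac{(n+1)\pi}{n + 3} \right)} \prod_{\substack{m=1 \\ m \neq j}}^{(n-1)/2} (t - \lambda_{2m}).$$ $\mathbf{O}$ and $\mathbf{0}$ are zero blocks; for $n=1$ blocks of size $(n-1)/2=0$ are absent. *)

theory Defs
  imports
    Complex_Main
    "HOL-Computational_Algebra.Polynomial"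
    "Jordan_Normal_Form.Matrix"
    "Jordan_Normal_Form.Char_Poly"
begin

(* Vectors and matrices of the library are indexed from 0; these two constructors take the
   entry as a function of indices starting at 1, so that the formulas below need no shift. *)

definition vec1 :: "nat \<Rightarrow> (nat \<Rightarrow> real) \<Rightarrow> real vec" where
  "vec1 m f = vec m (\<lambda>i. f (i + 1))"

definition mat1 :: "nat \<Rightarrow> nat \<Rightarrow> (nat \<Rightarrow> nat \<Rightarrow> real) \<Rightarrow> real mat" where
  "mat1 m r f = mat m r (\<lambda>(i, j). f (i + 1) (j + 1))"

(* The index conditions are over int because subtraction on nat truncates; so also in P_even and P_odd. *)
definition hankel :: "nat \<Rightarrow> real \<Rightarrow> real \<Rightarrow> real \<Rightarrow> real \<Rightarrow> real mat" where
  "hankel n a b c d = mat1 n n (\<lambda>k l.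
     let e = \<bar>int k + int l - int n - 1\<bar> in
       if e = 0 then d else if e = 1 then c else if e = 2 then b else if e = 3 then a else 0)"

definition lam :: "nat \<Rightarrow> real \<Rightarrow> real \<Rightarrow> real \<Rightarrow> real \<Rightarrow> nat \<Rightarrow> real" where
  "lam n a b c d k =
     - 2 * a * cos (real n * real k * pi / real (n + 3))
     - 2 * b * cos (real (n + 1) * real k * pi / real (n + 3))
     - 2 * c * cos (real (n + 2) * real k * pi / real (n + 3))
     - d * cos (real k * pi)"

definition sine :: "nat \<Rightarrow> nat \<Rightarrow> real" where
  "sine n m = sin (real m * pi / real (n + 3))"

definition outer :: "real vec \<Rightarrow> real mat" where
  "outer w = mat_of_cols (dim_vec w) [w] * transpose_mat (mat_of_cols (dim_vec w) [w])"

definition block_mat :: "real vec \<Rightarrow> real vec \<Rightarrow> real mat" where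
  "block_mat u v =
     four_block_mat
       (1\<^sub>m (dim_vec u) + outer u) (0\<^sub>m (dim_vec u) (dim_vec v))
       (0\<^sub>m (dim_vec v) (dim_vec u)) (1\<^sub>m (dim_vec v) + outer v)"

definition u_even :: "nat \<Rightarrow> real vec" where
  "u_even n = vec1 (n div 2) (\<lambda>j. sine n (2 * j + 1) / sine n 1)"

definition v_even :: "nat \<Rightarrow> real vec" where
  "v_even n = vec1 (n div 2) (\<lambda>j. sine n (2 * j) / sine n 1)"

definition R_even :: "nat \<Rightarrow> real mat" where
  "R_even n = mat1 n n (\<lambda>k l. sqrt (2 / real (n + 3)) * sine n ((k + 1) * (l + 1)))"

definition P_even :: "nat \<Rightarrow> real mat" where
  "P_even n = mat1 n n (\<lambda>k l.
     if int l = 2 * int k \<or> int l = 2 * int k - int n - 1 then 1 else 0)"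

definition f_even :: "nat \<Rightarrow> real \<Rightarrow> real \<Rightarrow> real \<Rightarrow> real \<Rightarrow> real poly" where
  "f_even n a b c d =
     (\<Prod>j\<in>{1..n div 2}. [:- lam n a b c d (2 * j + 1), 1:])
     + [:- lam n a b c d 1, 1:] *
       (\<Sum>j\<in>{1..n div 2}. Polynomial.smult ((sine n (2 * j + 1))\<^sup>2 / (sine n 1)\<^sup>2)
          (\<Prod>m\<in>{1..n div 2} - {j}. [:- lam n a b c d (2 * m + 1), 1:]))"

definition g_even :: "nat \<Rightarrow> real \<Rightarrow> real \<Rightarrow> real \<Rightarrow> real \<Rightarrow> real poly" where
  "g_even n a b c d =
     (\<Prod>j\<in>{1..n div 2}. [:- lam n a b c d (2 * j), 1:])
     + [:- lam n a b c d (n + 2), 1:] *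
       (\<Sum>j\<in>{1..n div 2}. Polynomial.smult ((sine n (2 * j))\<^sup>2 / (sine n 1)\<^sup>2)
          (\<Prod>m\<in>{1..n div 2} - {j}. [:- lam n a b c d (2 * m), 1:]))"

definition u_odd :: "nat \<Rightarrow> real vec" where
  "u_odd n = vec1 ((n + 1) div 2) (\<lambda>j. sine n (2 * j + 1) / sine n 1)"

definition v_odd :: "nat \<Rightarrow> real vec" where
  "v_odd n = vec1 ((n - 1) div 2) (\<lambda>j. sine n (2 * j) / sine n (n + 1))"

definition R_odd :: "nat \<Rightarrow> real mat" where
  "R_odd n = mat1 n n (\<lambda>k l. sqrt (2 / real (n + 3)) *
     (if l < n then sine n ((k + 1) * (l + 1)) else sine n ((k + 1) * (n + 2))))"

definition P_odd :: "nat \<Rightarrow> real mat" where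
  "P_odd n = mat1 n n (\<lambda>k l.
     if int k = 2 * int l \<or> int k = 2 * int l - int n - 2 \<or> (k = n \<and> l = (n + 1) div 2)
     then 1 else 0)"

definition f_odd :: "nat \<Rightarrow> real \<Rightarrow> real \<Rightarrow> real \<Rightarrow> real \<Rightarrow> real poly" where
  "f_odd n a b c d =
     (\<Prod>j\<in>{1..(n + 1) div 2}. [:- lam n a b c d (2 * j + 1), 1:])
     + [:- lam n a b c d 1, 1:] *
       (\<Sum>j\<in>{1..(n + 1) div 2}. Polynomial.smult ((sine n (2 * j + 1))\<^sup>2 / (sine n 1)\<^sup>2)
          (\<Prod>m\<in>{1..(n + 1) div 2} - {j}. [:- lam n a b c d (2 * m + 1), 1:]))"

definition g_odd :: "nat \<Rightarrow> real \<Rightarrow> real \<Rightarrow> real \<Rightarrow> real \<Rightarrow> real poly" where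
  "g_odd n a b c d =
     (\<Prod>j\<in>{1..(n - 1) div 2}. [:- lam n a b c d (2 * j), 1:])
     + [:- lam n a b c d (n + 1), 1:] *
       (\<Sum>j\<in>{1..(n - 1) div 2}. Polynomial.smult ((sine n (2 * j))\<^sup>2 / (sine n (n + 1))\<^sup>2)
          (\<Prod>m\<in>{1..(n - 1) div 2} - {j}. [:- lam n a b c d (2 * m), 1:]))"

end

theory Submission
  imports Defs
begin

text \<open>
  Put \<open>N = n + 3\<close>. The untruncated anti-band operator maps each mode \<open>s_m(j) = sin (j m pi / N)\<close> to
  \<open>\<lambda>_m s_m\<close>, and the matrix is its compression to the positions \<open>2, \<dots>, N - 2\<close>. Within one parity
  class of \<open>m\<close> take \<open>y = (\<Sum>m. s_m(1) / (\<mu> - \<lambda>_m) s_m)\<close>. A zero \<open>\<mu>\<close> of the polynomial solves the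
  secular equation \<open>(\<Sum>m. s_m(1)^2 / (\<mu> - \<lambda>_m)) = 0\<close>, that is \<open>y(1) = 0\<close>, so by symmetry \<open>y\<close>
  vanishes at both ends and the truncation is invisible on \<open>y\<close>. Applying \<open>\<mu>\<close> minus the operator leaves
  \<open>(\<Sum>m. s_m(1) s_m)\<close>, which by completeness is supported at the two ends. Completeness also expresses
  one mode through the others on \<open>2, \<dots>, N - 2\<close>, and eliminating it from \<open>y\<close> produces the
  rank-one corrections in the stated eigenvectors.
\<close>

section \<open>Cosine sums and orthogonality of sines\<close>

text \<open>Multiplication by \<open>2 * sin h\<close>, with \<open>h\<close> half the angle between
  consecutive terms, makes the sum telescope. The bounds on \<open>r\<close> keep \<open>h\<close>
  strictly between 0 and pi, so \<open>sin h\<close> can be cancelled.\<close>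

lemma cos_sum_vanish:
  fixes N r :: nat
  assumes "0 < r" "r < 2 * N"
  shows "(\<Sum>j<N. cos (real j * real r * pi / real N)) = (if even r then 0 else 1)"
proof -
  let ?h = "real r * pi / (2 * real N)"
  have N: "N > 0" using assms by linarith
  have "?h < pi" using assms N by (simp add: divide_less_eq)
  then have h: "sin ?h > 0" using assms N by (intro sin_gt_zero) auto
  have tel: "2 * sin ?h * (\<Sum>j<k. cos (real j * real r * pi / real N))
      = sin ((2 * real k - 1) * ?h) + sin ?h" for k
  proof (induction k)
    case 0
    then show ?case by (simp add: algebra_simps)
  next
    case (Suc k)
    have "2 * sin ?h * cos (real k * real r * pi / real N)
        = sin ((2 * real (Suc k) - 1) * ?h) - sin ((2 * real k - 1) * ?h)"
    proof -
      have e: "real k * real r * pi / real N = 2 * real k * ?h" using N by simp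
      have "(2 * real (Suc k) - 1) * ?h = 2 * real k * ?h + ?h"
        "(2 * real k - 1) * ?h = 2 * real k * ?h - ?h"
        by (simp_all only: algebra_simps of_nat_Suc)
      then show ?thesis unfolding e by (simp only: sin_add sin_diff) simp
    qed
    with Suc show ?case by (simp only: sum.lessThan_Suc distrib_left)
  qed
  \<comment> \<open>The telescope ends at the angle \<open>r * pi - h\<close>, whose sine cancels
    the term \<open>sin h\<close> for even \<open>r\<close> and doubles it for odd
    \<open>r\<close>.\<close>
  have "(2 * real N - 1) * ?h = real r * pi - ?h" using N by (simp add: field_simps)
  then have "sin ((2 * real N - 1) * ?h) = (if even r then - sin ?h else sin ?h)"
    by (simp add: sin_diff sin_npi cos_npi)
  with tel[of N] h show ?thesis by (auto split: if_splits)
qed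

text \<open>Product-to-sum gives cosine sums at the frequencies \<open>m - l\<close> and
  \<open>m + l\<close>. These have the same parity, so by \<open>cos_sum_vanish\<close> the sums
  cancel unless \<open>m = l\<close>; then every term of the first is 1 and the second is 0.\<close>

lemma sine_orthogonal:
  fixes N m l :: nat
  assumes "m \<in> {1..<N}" "l \<in> {1..<N}"
  shows "(\<Sum>j<N. sin (real j * real m * pi / real N) * sin (real j * real l * pi / real N))
    = (if m = l then real N / 2 else 0)"
proof -
  \<comment> \<open>The case \<open>l \<le> m\<close> comes first because \<open>m - l\<close> is a
    natural subtraction; symmetry gives the other one.\<close>
  have *: "(\<Sum>j<N. sin (real j * real m * pi / real N) * sin (real j * real l * pi / real N))
    = (if m = l then real N / 2 else 0)"
    if "m \<in> {1..<N}" "l \<in> {1..<N}" "l \<le> m" for m l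
  proof -
    have "sin (real j * real m * pi / real N) * sin (real j * real l * pi / real N)
      = (cos (real j * real (m - l) * pi / real N) - cos (real j * real (m + l) * pi / real N)) / 2" for j
    proof -
      have "real j * real (m - l) * pi / real N
          = real j * real m * pi / real N - real j * real l * pi / real N"
        "real j * real (m + l) * pi / real N
          = real j * real m * pi / real N + real j * real l * pi / real N"
        using \<open>l \<le> m\<close> by (simp_all add: of_nat_diff algebra_simps diff_divide_distrib add_divide_distrib)
      then show ?thesis by (simp add: sin_times_sin)
    qed
    then have "(\<Sum>j<N. sin (real j * real m * pi / real N) * sin (real j * real l * pi / real N))
      = ((\<Sum>j<N. cos (real j * real (m - l) * pi / real N))
         - (\<Sum>j<N. cos (real j * real (m + l) * pi / real N))) / 2"
      by (simp only: sum_subtractf sum_divide_distrib[symmetric])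
    moreover have "(\<Sum>j<N. cos (real j * real (m + l) * pi / real N)) = (if even m = even l then 0 else 1)"
      using that by (subst cos_sum_vanish) auto
    moreover have "(\<Sum>j<N. cos (real j * real (m - l) * pi / real N))
        = (if m = l then real N else if even m = even l then 0 else 1)"
    proof (cases "m = l")
      case False
      then show ?thesis using that by (subst cos_sum_vanish) auto
    qed simp
    ultimately show ?thesis by (simp only:) simp
  qed
  show ?thesis
  proof (cases "l \<le> m")
    case True
    then show ?thesis using * assms by blast
  next
    case False
    then show ?thesis using *[of l m] assms by (simp add: mult.commute)
  qed
qed

section \<open>Sine modes and their symmetries\<close>

text \<open>Positions are integers because the untruncated band reaches beyond both ends, down to
  \<open>-1\<close> and up to \<open>n + 4\<close>.\<close>

definition mode :: "nat \<Rightarrow> nat \<Rightarrow> int \<Rightarrow> real" where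
  "mode n m j = sin (real_of_int j * real m * pi / real (n + 3))"

lemma sine_eq_mode: "sine n (k * m) = mode n m (int k)"
  by (simp add: sine_def mode_def mult.assoc)

lemma mode_1: "mode n m 1 = sine n m"
  by (simp add: sine_def mode_def)

lemma mode_uminus: "mode n m (- j) = - mode n m j"
  by (simp add: mode_def)

lemma mode_0: "mode n m 0 = 0"
  by (simp add: mode_def)

text \<open>The sign is +1 for odd \<open>m\<close> and -1 for even \<open>m\<close>: the parity of
  the mode number is the parity under reflection.\<close>

lemma mode_reflect: "mode n m (int n + 3 - j) = - cos (real m * pi) * mode n m j"
proof -
  have "real_of_int (int n + 3 - j) * real m * pi / real (n + 3)
      = real m * pi - real_of_int j * real m * pi / real (n + 3)"
    by (simp add: field_simps)
  then show ?thesis unfolding mode_def by (simp only:) (simp add: sin_diff sin_npi cos_npi)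
qed

lemma mode_shift:
  "mode n m (j + e) + mode n m (j - e) = 2 * cos (real_of_int e * real m * pi / real (n + 3)) * mode n m j"
proof -
  have "real_of_int (j + e) * real m * pi / real (n + 3)
      = real_of_int j * real m * pi / real (n + 3) + real_of_int e * real m * pi / real (n + 3)"
    "real_of_int (j - e) * real m * pi / real (n + 3)
      = real_of_int j * real m * pi / real (n + 3) - real_of_int e * real m * pi / real (n + 3)"
    by (simp_all add: algebra_simps add_divide_distrib diff_divide_distrib)
  then show ?thesis unfolding mode_def by (simp only: sin_add sin_diff) simp
qed

text \<open>Writing \<open>n + i\<close> as \<open>N - (3 - i)\<close> splits the sign
  \<open>cos (m pi)\<close> off each cosine. This exhibits \<open>lam\<close> as a product of two
  eigenvalues on mode \<open>m\<close>: that of the reflection, and that of the symmetric Toeplitz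
  band with entries \<open>d\<close>, \<open>c\<close>, \<open>b\<close>, \<open>a\<close> at
  distances 0 to 3.\<close>

lemma lam_alt:
  "lam n a b c d m = - cos (real m * pi) *
     (d + 2 * c * cos (real m * pi / real (n + 3)) + 2 * b * cos (2 * real m * pi / real (n + 3))
        + 2 * a * cos (3 * real m * pi / real (n + 3)))"
proof -
  have "cos (real (n + i) * real m * pi / real (n + 3))
      = cos (real m * pi) * cos ((3 - real i) * real m * pi / real (n + 3))" for i
  proof -
    have "real (n + i) * real m * pi / real (n + 3)
        = real m * pi - (3 - real i) * real m * pi / real (n + 3)"
      by (simp add: field_simps)
    then show ?thesis by (simp only:) (simp add: cos_diff sin_npi cos_npi)
  qed
  from this[of 0] this[of 1] this[of 2] show ?thesis
    unfolding lam_def by (simp add: algebra_simps)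
qed

section \<open>The band operator and its truncation\<close>

definition band :: "real \<Rightarrow> real \<Rightarrow> real \<Rightarrow> real \<Rightarrow> int \<Rightarrow> real" where
  "band a b c d e = (if e = 0 then d else if \<bar>e\<bar> = 1 then c else if \<bar>e\<bar> = 2 then b
     else if \<bar>e\<bar> = 3 then a else 0)"

text \<open>Row \<open>j\<close> of the anti-band is centred at the reflected position
  \<open>N - j\<close>. Opposite offsets pair up by \<open>mode_shift\<close> into multiples of the
  value at the centre, and \<open>mode_reflect\<close> carries the centre back to
  \<open>j\<close>.\<close>

lemma sum_band_mode:
  "(\<Sum>e\<in>{-3..3}. band a b c d e * mode n m (int n + 3 - j + e)) = lam n a b c d m * mode n m j"
proof -
  have s: "{-3..3::int} = {-3,-2,-1,0,1,2,3}" by auto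
  let ?p = "int n + 3 - j"
  have "(\<Sum>e\<in>{-3..3}. band a b c d e * mode n m (?p + e))
     = d * mode n m ?p + c * (mode n m (?p + 1) + mode n m (?p - 1))
       + b * (mode n m (?p + 2) + mode n m (?p - 2)) + a * (mode n m (?p + 3) + mode n m (?p - 3))"
    unfolding s by (simp add: band_def algebra_simps)
  also have "\<dots> = lam n a b c d m * mode n m j"
    unfolding mode_shift mode_reflect lam_alt by (simp add: algebra_simps)
  finally show ?thesis .
qed

text \<open>Position \<open>j\<close> of \<open>y\<close> is entry \<open>j - 2\<close> of the 0-indexed vector: the matrix sits in rows
  \<open>2, \<dots>, n + 1\<close> of an untruncated band, whose overhang meets only zeros of \<open>y\<close>.\<close>

lemma hankel_row:
  fixes y :: "int \<Rightarrow> real"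
  assumes z: "\<And>j. j \<in> {-1, 0, 1, int n + 2, int n + 3, int n + 4} \<Longrightarrow> y j = 0"
    and k: "k < n"
  shows "(hankel n a b c d *\<^sub>v vec n (\<lambda>i. y (int i + 2))) $ k
    = (\<Sum>e\<in>{-3..3}. band a b c d e * y (int n + 3 - (int k + 2) + e))"
proof -
  let ?h = "\<lambda>j. band a b c d (j - (int n + 3 - (int k + 2))) * y j"
  have "(hankel n a b c d *\<^sub>v vec n (\<lambda>i. y (int i + 2))) $ k = (\<Sum>i\<in>{0..<n}. ?h (int i + 2))"
  proof -
    have "hankel n a b c d $$ (k, i) = band a b c d (int i + 2 - (int n + 3 - (int k + 2)))"
      if "i < n" for i
    proof -
      have "int (k + 1) + int (i + 1) - int n - 1 = int i + 2 - (int n + 3 - (int k + 2))" by simp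
      then show ?thesis
        using k that by (simp only: hankel_def mat1_def index_mat prod.case band_def Let_def abs_eq_0)
    qed
    moreover have "dim_row (hankel n a b c d) = n" "dim_col (hankel n a b c d) = n"
      by (simp_all add: hankel_def mat1_def)
    ultimately show ?thesis
      using k by (simp add: scalar_prod_def)
  qed
  also have "\<dots> = (\<Sum>j\<in>{2..<int n + 2}. ?h j)"
    by (rule sum.reindex_bij_witness[of _ "\<lambda>j. nat (j - 2)" "\<lambda>i. int i + 2"]) auto
  \<comment> \<open>The seven positions around the centre \<open>n + 1 - k\<close> lie in this range
    for every row \<open>k < n\<close>. Widening to it therefore completes the band, and the sum can
    then be cut down to those seven.\<close>
  also have "\<dots> = (\<Sum>j\<in>{-1..int n + 4}. ?h j)"
  proof (rule sum.mono_neutral_left)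
    show "\<forall>j\<in>{-1..int n + 4} - {2..<int n + 2}. ?h j = 0"
    proof
      fix j assume "j \<in> {-1..int n + 4} - {2..<int n + 2}"
      then have "j \<in> {-1, 0, 1, int n + 2, int n + 3, int n + 4}" by auto
      then show "?h j = 0" using z by simp
    qed
  qed auto
  also have "\<dots> = (\<Sum>j\<in>{int n - int k - 2..int n - int k + 4}. ?h j)"
    using k by (intro sum.mono_neutral_right) (auto simp: band_def)
  also have "\<dots> = (\<Sum>e\<in>{-3..3}. band a b c d e * y (int n + 3 - (int k + 2) + e))"
    by (rule sum.reindex_bij_witness[of _ "\<lambda>e. int n - int k + 1 + e" "\<lambda>j. j - (int n - int k + 1)"])
       (auto simp: algebra_simps)
  finally show ?thesis .
qed

section \<open>Parity classes of modes and completeness\<close>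

text \<open>By \<open>mode_reflect\<close> the class \<open>False\<close> holds the symmetric modes,
  which belong to the polynomial f, and \<open>True\<close> the antisymmetric ones, which belong to
  g.\<close>

definition modes :: "nat \<Rightarrow> bool \<Rightarrow> nat set" where
  "modes n e = {m \<in> {1..n + 2}. even m = e}"

lemma finite_modes: "finite (modes n e)"
  by (simp add: modes_def)

lemma sine_pos: "m \<in> modes n e \<Longrightarrow> sine n m > 0"
  unfolding sine_def modes_def by (intro sin_gt_zero) (auto simp: divide_less_eq)

lemma mode_reflect_modes:
  "m \<in> modes n e \<Longrightarrow> mode n m (int n + 3 - j) = (if e then - mode n m j else mode n m j)"
  unfolding mode_reflect by (auto simp: modes_def cos_npi)

lemma mode_commute: "mode n m (int j) = mode n j (int m)"
  by (simp add: mode_def mult.commute)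

lemma mode_orthogonal:
  assumes "m \<in> {1..n + 2}" "l \<in> {1..n + 2}"
  shows "(\<Sum>j<n+3. mode n m (int j) * mode n l (int j)) = (if m = l then real (n + 3) / 2 else 0)"
  using sine_orthogonal[of m "n + 3" l] assms by (auto simp: mode_def)

text \<open>A mode is symmetric in its number and its position, so orthogonality can be read as a
  sum over mode numbers at two fixed positions. Averaging the positions \<open>j\<close> and
  \<open>N - j\<close> with the sign of the class selects one parity.\<close>

lemma modes_complete:
  assumes "j \<in> {2..n + 1}"
  shows "(\<Sum>m\<in>modes n e. sine n m * mode n m (int j)) = 0"
proof -
  let ?s = "if e then - 1 else 1 :: real"
  have "(\<Sum>m\<in>modes n e. sine n m * mode n m (int j))
      = (\<Sum>m\<in>modes n e. (mode n m (int j) + ?s * mode n m (int n + 3 - int j)) / 2 * mode n m 1)"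
    by (intro sum.cong refl) (simp add: mode_reflect_modes mode_1)
  \<comment> \<open>The averaged factor is zero on modes of the other parity, and mode 0 vanishes
    identically, so the sum may run over all \<open>m\<close>.\<close>
  also have "\<dots> = (\<Sum>m<n+3. (mode n m (int j) + ?s * mode n m (int n + 3 - int j)) / 2 * mode n m 1)"
  proof (rule sum.mono_neutral_left)
    show "\<forall>m\<in>{..<n+3} - modes n e.
        (mode n m (int j) + ?s * mode n m (int n + 3 - int j)) / 2 * mode n m 1 = 0"
    proof
      fix m assume m: "m \<in> {..<n+3} - modes n e"
      then consider "m = 0" | "m \<in> modes n (\<not> e)" by (force simp: modes_def)
      then show "(mode n m (int j) + ?s * mode n m (int n + 3 - int j)) / 2 * mode n m 1 = 0"
      proof cases
        case 1
        then show ?thesis by (simp add: mode_def)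
      next
        case 2
        then show ?thesis by (auto simp: mode_reflect_modes)
      qed
    qed
  qed (auto simp: modes_def)
  also have "\<dots> = ((\<Sum>m<n+3. mode n j (int m) * mode n 1 (int m))
      + ?s * (\<Sum>m<n+3. mode n (n + 3 - j) (int m) * mode n 1 (int m))) / 2"
  proof -
    have "mode n m 1 = mode n 1 (int m)" "mode n m (int n + 3 - int j) = mode n (n + 3 - j) (int m)" for m
      using mode_commute[of n m 1] mode_commute[of n m "n + 3 - j"] assms by (simp_all add: of_nat_diff)
    then show ?thesis
      unfolding mode_commute[of n _ j]
      by (simp only: sum_distrib_left sum.distrib[symmetric] sum_divide_distrib)
         (intro sum.cong refl, simp add: field_simps)
  qed
  \<comment> \<open>For \<open>j\<close> between 2 and \<open>n + 1\<close>, both \<open>j\<close>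
    and \<open>N - j\<close> differ from 1.\<close>
  also have "\<dots> = 0"
    using assms by (subst (1 2) mode_orthogonal) auto
  finally show ?thesis .
qed

section \<open>Eigenvectors and the secular equation\<close>

lemma hankel_eigenvector:
  assumes ne: "modes n e \<noteq> {}" and k0: "\<kappa> \<noteq> 0"
    and \<mu>: "\<And>m. m \<in> modes n e \<Longrightarrow> \<mu> \<noteq> lam n a b c d m"
    and secular: "(\<Sum>m\<in>modes n e. (sine n m)\<^sup>2 / (\<mu> - lam n a b c d m)) = 0"
  defines "y \<equiv> \<lambda>j. \<kappa> * (\<Sum>m\<in>modes n e. sine n m / (\<mu> - lam n a b c d m) * mode n m j)"
  shows "eigenvector (hankel n a b c d) (vec n (\<lambda>i. y (int i + 2))) \<mu>"
proof -
  have y0: "y 0 = 0" by (simp add: y_def mode_0)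
  have y1: "y 1 = 0" using secular by (simp add: y_def mode_1 power2_eq_square)
  have yneg: "y (- j) = - y j" for j
    by (simp add: y_def mode_uminus sum_negf)
  have yrefl: "y (int n + 3 - j) = (if e then - y j else y j)" for j
    by (simp add: y_def mode_reflect_modes sum_negf cong: sum.cong)
  have z: "y j = 0" if "j \<in> {-1, 0, 1, int n + 2, int n + 3, int n + 4}" for j
  proof -
    have ym1: "y (-1) = 0" using y1 yneg[of 1] by simp
    have "y (int n + 3 - i) = 0" if "y i = 0" for i
      using that yrefl[of i] by (cases e) simp_all
    from this[OF y1] this[OF y0] this[OF ym1] have "y (int n + 2) = 0" "y (int n + 3) = 0" "y (int n + 4) = 0"
      by (simp_all add: add.commute)
    then show ?thesis using that y0 y1 ym1 by blast
  qed
  have "hankel n a b c d *\<^sub>v vec n (\<lambda>i. y (int i + 2)) = \<mu> \<cdot>\<^sub>v vec n (\<lambda>i. y (int i + 2))"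
  proof (rule eq_vecI)
    fix k assume "k < dim_vec (\<mu> \<cdot>\<^sub>v vec n (\<lambda>i. y (int i + 2)))"
    then have k: "k < n" by simp
    let ?w = "\<lambda>m. sine n m / (\<mu> - lam n a b c d m)"
    have "(hankel n a b c d *\<^sub>v vec n (\<lambda>i. y (int i + 2))) $ k
        = (\<Sum>i\<in>{-3..3}. band a b c d i * y (int n + 3 - (int k + 2) + i))"
      using z k by (rule hankel_row)
    also have "\<dots> = (\<Sum>i\<in>{-3..3}. \<Sum>m\<in>modes n e.
        \<kappa> * ?w m * (band a b c d i * mode n m (int n + 3 - (int k + 2) + i)))"
      unfolding y_def by (simp add: sum_distrib_left mult_ac)
    also have "\<dots> = (\<Sum>m\<in>modes n e. \<kappa> * ?w m * (lam n a b c d m * mode n m (int k + 2)))"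
      by (subst sum.swap) (simp only: sum_band_mode sum_distrib_left[symmetric])
    also have "\<dots> = (\<Sum>m\<in>modes n e. \<mu> * (\<kappa> * (?w m * mode n m (int k + 2)))
        - \<kappa> * (sine n m * mode n m (int k + 2)))"
    proof (intro sum.cong refl)
      fix m assume "m \<in> modes n e"
      then have "\<mu> - lam n a b c d m \<noteq> 0" using \<mu> by auto
      \<comment> \<open>This is \<open>\<lambda> / (\<mu> - \<lambda>) = \<mu> / (\<mu> - \<lambda>)
        - 1\<close>: the operator acts as \<open>\<mu>\<close> up to an error that
        \<open>modes_complete\<close> removes.\<close>
      then have "?w m * lam n a b c d m = \<mu> * ?w m - sine n m" by (simp add: field_simps)
      then have "?w m * lam n a b c d m * (\<kappa> * mode n m (int k + 2))
          = (\<mu> * ?w m - sine n m) * (\<kappa> * mode n m (int k + 2))" by (simp only:)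
      then show "\<kappa> * ?w m * (lam n a b c d m * mode n m (int k + 2))
          = \<mu> * (\<kappa> * (?w m * mode n m (int k + 2))) - \<kappa> * (sine n m * mode n m (int k + 2))"
        by (simp only: algebra_simps)
    qed
    also have "\<dots> = \<mu> * y (int k + 2) - \<kappa> * (\<Sum>m\<in>modes n e. sine n m * mode n m (int k + 2))"
      by (simp only: sum_subtractf y_def sum_distrib_left)
    also have "(\<Sum>m\<in>modes n e. sine n m * mode n m (int k + 2)) = 0"
      using modes_complete[of "k + 2" n e] k by (simp add: add.commute)
    finally show "(hankel n a b c d *\<^sub>v vec n (\<lambda>i. y (int i + 2))) $ k
        = (\<mu> \<cdot>\<^sub>v vec n (\<lambda>i. y (int i + 2))) $ k"
      using k by simp
  qed (simp add: hankel_def mat1_def)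
  \<comment> \<open>If the vector were zero, \<open>y\<close> would vanish on all of
    \<open>0, \<dots>, n + 2\<close>, since its values at 0, 1 and \<open>n + 2\<close> are zero
    anyway. Orthogonality against a single mode \<open>l\<close> then isolates its coefficient,
    which is nonzero.\<close>
  moreover have "vec n (\<lambda>i. y (int i + 2)) \<noteq> 0\<^sub>v n"
  proof
    assume v: "vec n (\<lambda>i. y (int i + 2)) = 0\<^sub>v n"
    have yall: "y (int j) = 0" if "j < n + 3" for j
    proof (cases "j \<in> {0, 1, n + 2}")
      case True
      then have "int j \<in> {-1, 0, 1, int n + 2, int n + 3, int n + 4}" by force
      then show ?thesis by (rule z)
    next
      case False
      then have "j - 2 < n" "int (j - 2) + 2 = int j" using that by auto
      then show ?thesis using arg_cong[OF v, of "\<lambda>x. x $ (j - 2)"] by simp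
    qed
    obtain l where l: "l \<in> modes n e" using ne by blast
    let ?w = "\<lambda>m. sine n m / (\<mu> - lam n a b c d m)"
    have "0 = (\<Sum>j<n+3. y (int j) * mode n l (int j))" using yall by simp
    also have "\<dots> = (\<Sum>j<n+3. \<Sum>m\<in>modes n e. \<kappa> * ?w m * (mode n m (int j) * mode n l (int j)))"
      unfolding y_def by (simp add: sum_distrib_left sum_distrib_right mult_ac)
    also have "\<dots> = (\<Sum>m\<in>modes n e. \<kappa> * ?w m * (\<Sum>j<n+3. mode n m (int j) * mode n l (int j)))"
      by (subst sum.swap) (simp only: sum_distrib_left)
    also have "\<dots> = (\<Sum>m\<in>modes n e. if m = l then \<kappa> * ?w m * (real (n + 3) / 2) else 0)"
      using l by (intro sum.cong refl, subst mode_orthogonal) (auto simp: modes_def)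
    also have "\<dots> = \<kappa> * ?w l * (real (n + 3) / 2)"
      using l finite_modes by (simp only: sum.delta if_True)
    also have "\<dots> \<noteq> 0" using k0 \<mu>[OF l] sine_pos[OF l] by simp
    finally show False by simp
  qed
  ultimately show ?thesis
    unfolding eigenvector_def by (simp add: hankel_def mat1_def)
qed

text \<open>Away from the poles, the left side of \<open>root\<close> is
  \<open>(\<Prod>i\<in>M. \<mu> - L i) / w i0\<close> times the secular sum. The poles are excluded
  first, since division by zero yields 0 and the secular sum would lose its meaning there.\<close>

lemma secular_equation:
  fixes w L :: "'a \<Rightarrow> 'b :: field"
  assumes "finite M" "i0 \<in> M" "inj_on L M" and w: "\<And>i. i \<in> M \<Longrightarrow> w i \<noteq> 0"
    and root: "(\<Prod>j\<in>M - {i0}. \<mu> - L j)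
      + (\<mu> - L i0) * (\<Sum>j\<in>M - {i0}. w j / w i0 * (\<Prod>m\<in>M - {i0} - {j}. \<mu> - L m)) = 0"
  shows "\<forall>i\<in>M. \<mu> \<noteq> L i" and "(\<Sum>i\<in>M. w i / (\<mu> - L i)) = 0"
proof -
  let ?J = "M - {i0}"
  have fin: "finite ?J" using assms by simp
  show ne: "\<forall>i\<in>M. \<mu> \<noteq> L i"
  proof (rule ccontr)
    assume "\<not> ?thesis"
    then obtain i where i: "i \<in> M" "\<mu> = L i" by blast
    have other: "\<mu> \<noteq> L j" if "j \<in> M" "j \<noteq> i" for j
      using i that \<open>inj_on L M\<close> by (auto simp: inj_on_def)
    \<comment> \<open>By injectivity only one factor \<open>\<mu> - L i\<close> vanishes. A single
      product survives in \<open>root\<close>: the leading one if \<open>i = i0\<close>, otherwise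
      the summand of index \<open>i\<close>; all its factors are nonzero.\<close>
    show False
    proof (cases "i = i0")
      case True
      then have "(\<Prod>j\<in>?J. \<mu> - L j) = 0" using root i by simp
      then show False using other True fin by (auto simp: prod_zero_iff)
    next
      case False
      then have iJ: "i \<in> ?J" using i by simp
      have "(\<Prod>j\<in>?J. \<mu> - L j) = 0" using iJ fin i by (auto simp: prod_zero_iff)
      moreover have "\<mu> - L i0 \<noteq> 0" using other[of i0] False assms(2) by auto
      moreover have "(\<Sum>j\<in>?J. w j / w i0 * (\<Prod>m\<in>?J - {j}. \<mu> - L m))
          = (\<Sum>j\<in>?J. if j = i then w j / w i0 * (\<Prod>m\<in>?J - {j}. \<mu> - L m) else 0)"
        using iJ fin i by (intro sum.cong refl) (auto simp: prod_zero_iff)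
      ultimately have "w i / w i0 * (\<Prod>m\<in>?J - {i}. \<mu> - L m) = 0"
        using root iJ fin by (simp add: sum.delta del: divide_eq_0_iff)
      then show False using w[of i] w[of i0] i assms(2) other fin by (auto simp: prod_zero_iff)
    qed
  qed
  let ?P = "\<Prod>j\<in>?J. \<mu> - L j"
  have P: "?P \<noteq> 0" using ne fin by (auto simp: prod_zero_iff)
  have d: "\<mu> - L i0 \<noteq> 0" using ne assms(2) by auto
  have w0: "w i0 \<noteq> 0" using w assms(2) by blast
  have "(\<Sum>j\<in>?J. w j / w i0 * (\<Prod>m\<in>?J - {j}. \<mu> - L m)) = ?P / w i0 * (\<Sum>j\<in>?J. w j / (\<mu> - L j))"
    unfolding sum_distrib_left
  proof (intro sum.cong refl)
    fix j assume j: "j \<in> ?J"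
    have "?P = (\<mu> - L j) * (\<Prod>m\<in>?J - {j}. \<mu> - L m)" using j fin by (rule prod.remove[rotated])
    moreover have "\<mu> - L j \<noteq> 0" using ne j by auto
    ultimately show "w j / w i0 * (\<Prod>m\<in>?J - {j}. \<mu> - L m) = ?P / w i0 * (w j / (\<mu> - L j))"
      by simp
  qed
  with root have "?P + (\<mu> - L i0) * (?P / w i0 * (\<Sum>j\<in>?J. w j / (\<mu> - L j))) = 0"
    by (simp only:)
  then have "?P * (1 + (\<mu> - L i0) / w i0 * (\<Sum>j\<in>?J. w j / (\<mu> - L j))) = 0"
    by (simp add: distrib_left mult_ac)
  with P have "1 + (\<mu> - L i0) / w i0 * (\<Sum>j\<in>?J. w j / (\<mu> - L j)) = 0" by simp
  with d w0 have "w i0 / (\<mu> - L i0) + (\<Sum>j\<in>?J. w j / (\<mu> - L j)) = 0"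
    by (simp add: field_simps)
  then show "(\<Sum>i\<in>M. w i / (\<mu> - L i)) = 0"
    using assms(1,2) by (simp add: sum.remove)
qed

text \<open>The rank-one correction in \<open>q\<close> supplies the missing mode \<open>m0\<close>: by the secular equation its
  coefficient is that of \<open>m0\<close> in the eigenvector above, and by completeness the other modes weighted
  by \<open>u\<close> add up to minus the mode \<open>m0\<close>.\<close>

lemma hankel_eigenvector_reduced:
  fixes \<sigma> :: "nat \<Rightarrow> nat"
  assumes bij: "bij_betw \<sigma> {1..r} (modes n e - {m0})" and m0: "m0 \<in> modes n e"
    and inj: "inj_on (lam n a b c d) (modes n e)" and k0: "\<kappa> \<noteq> 0"
    and root: "(\<Prod>j\<in>{1..r}. \<mu> - lam n a b c d (\<sigma> j)) + (\<mu> - lam n a b c d m0) *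
      (\<Sum>j\<in>{1..r}. (sine n (\<sigma> j))\<^sup>2 / (sine n m0)\<^sup>2 *
         (\<Prod>m\<in>{1..r} - {j}. \<mu> - lam n a b c d (\<sigma> m))) = 0"
  defines "u \<equiv> \<lambda>j. sine n (\<sigma> j) / sine n m0"
    and "p \<equiv> \<lambda>j. sine n (\<sigma> j) / ((\<mu> - lam n a b c d (\<sigma> j)) * sine n m0)"
  defines "q \<equiv> \<lambda>j. p j + u j * (\<Sum>i\<in>{1..r}. u i * p i)"
  shows "eigenvector (hankel n a b c d)
    (vec1 n (\<lambda>k. \<Sum>j\<in>{1..r}. \<kappa> * sine n ((k + 1) * \<sigma> j) * q j)) \<mu>"
proof -
  let ?L = "lam n a b c d" and ?J = "modes n e - {m0}"
  let ?w = "\<lambda>m. sine n m / (\<mu> - ?L m)"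
  have inj_\<sigma>: "inj_on \<sigma> {1..r}" and im: "\<sigma> ` {1..r} = ?J" using bij by (auto simp: bij_betw_def)
  have reindex: "(\<Sum>j\<in>{1..r}. h (\<sigma> j)) = (\<Sum>m\<in>?J. h m)" for h :: "nat \<Rightarrow> real"
    using bij by (rule sum.reindex_bij_betw)
  have "(\<Prod>m\<in>{1..r} - {j}. \<mu> - ?L (\<sigma> m)) = (\<Prod>m\<in>?J - {\<sigma> j}. \<mu> - ?L m)" if "j \<in> {1..r}" for j
  proof -
    have "bij_betw \<sigma> ({1..r} - {j}) (?J - {\<sigma> j})"
      using bij that by (intro bij_betw_DiffI) (auto simp: bij_betw_def)
    then show ?thesis by (rule prod.reindex_bij_betw)
  qed
  then have "(\<Sum>j\<in>{1..r}. (sine n (\<sigma> j))\<^sup>2 / (sine n m0)\<^sup>2 * (\<Prod>m\<in>{1..r} - {j}. \<mu> - ?L (\<sigma> m)))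
      = (\<Sum>m\<in>?J. (sine n m)\<^sup>2 / (sine n m0)\<^sup>2 * (\<Prod>i\<in>?J - {m}. \<mu> - ?L i))"
    by (subst reindex[symmetric]) simp
  moreover have "(\<Prod>j\<in>{1..r}. \<mu> - ?L (\<sigma> j)) = (\<Prod>m\<in>?J. \<mu> - ?L m)"
    using bij by (rule prod.reindex_bij_betw)
  ultimately have root': "(\<Prod>m\<in>?J. \<mu> - ?L m) + (\<mu> - ?L m0) *
      (\<Sum>m\<in>?J. (sine n m)\<^sup>2 / (sine n m0)\<^sup>2 * (\<Prod>i\<in>?J - {m}. \<mu> - ?L i)) = 0"
    using root by simp
  have pos: "(sine n m)\<^sup>2 \<noteq> 0" if "m \<in> modes n e" for m
    using sine_pos[OF that] by simp
  note sec = secular_equation[of "modes n e" m0 ?L "\<lambda>m. (sine n m)\<^sup>2", OF finite_modes m0 inj pos root']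
  have s0: "sine n m0 \<noteq> 0" using sine_pos[OF m0] by simp
  \<comment> \<open>Dividing the secular equation by the square of \<open>sine n m0\<close> turns
    its \<open>m0\<close> term into \<open>1 / (\<mu> - ?L m0)\<close>; the remaining terms are this
    inner product.\<close>
  have S: "(\<Sum>i\<in>{1..r}. u i * p i) = - 1 / (\<mu> - ?L m0)"
  proof -
    have "(\<Sum>i\<in>{1..r}. u i * p i) = (\<Sum>m\<in>?J. (sine n m)\<^sup>2 / (\<mu> - ?L m) / (sine n m0)\<^sup>2)"
      unfolding u_def p_def
      by (subst reindex[of "\<lambda>m. sine n m / sine n m0 * (sine n m / ((\<mu> - ?L m) * sine n m0))"])
         (simp add: power2_eq_square mult_ac)
    also have "\<dots> = ((\<Sum>m\<in>modes n e. (sine n m)\<^sup>2 / (\<mu> - ?L m)) - (sine n m0)\<^sup>2 / (\<mu> - ?L m0)) / (sine n m0)\<^sup>2"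
      using m0 finite_modes[of n e] by (simp add: sum.remove[of _ m0] sum_divide_distrib)
    finally show ?thesis using sec(2) s0 by simp
  qed
  \<comment> \<open>The free factor of \<open>hankel_eigenvector\<close> is taken to be
    \<open>\<kappa> / sine n m0\<close>, which merges the scale of the sine matrix with the common
    denominator in \<open>p\<close>.\<close>
  have "vec1 n (\<lambda>k. \<Sum>j\<in>{1..r}. \<kappa> * sine n ((k + 1) * \<sigma> j) * q j)
      = vec n (\<lambda>i. \<kappa> / sine n m0 * (\<Sum>m\<in>modes n e. ?w m * mode n m (int i + 2)))"
    unfolding vec1_def
  proof (rule eq_vecI)
    fix i assume "i < dim_vec (vec n (\<lambda>i. \<kappa> / sine n m0 * (\<Sum>m\<in>modes n e. ?w m * mode n m (int i + 2))))"
    then have i: "i < n" by simp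
    let ?g = "\<lambda>m. mode n m (int i + 2)"
    have sm: "sine n ((i + 1 + 1) * m) = ?g m" for m
      unfolding sine_eq_mode by (simp add: add.commute)
    have compl: "(\<Sum>m\<in>?J. sine n m * ?g m) = - (sine n m0 * ?g m0)"
      using modes_complete[of "i + 2" n e] i m0 finite_modes[of n e]
      by (simp add: sum.remove[of _ m0] add.commute)
    have "(\<Sum>j\<in>{1..r}. \<kappa> * sine n ((i + 1 + 1) * \<sigma> j) * q j)
        = (\<Sum>m\<in>?J. \<kappa> * ?g m * (sine n m / ((\<mu> - ?L m) * sine n m0)
             + sine n m / sine n m0 * (- 1 / (\<mu> - ?L m0))))"
      unfolding q_def S unfolding p_def u_def sm by (rule reindex)
    also have "\<dots> = (\<Sum>m\<in>?J. \<kappa> / sine n m0 * (?w m * ?g m)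
        - \<kappa> / (sine n m0 * (\<mu> - ?L m0)) * (sine n m * ?g m))"
      by (intro sum.cong refl) (simp add: algebra_simps)
    also have "\<dots> = \<kappa> / sine n m0 * (\<Sum>m\<in>?J. ?w m * ?g m)
        - \<kappa> / (sine n m0 * (\<mu> - ?L m0)) * (\<Sum>m\<in>?J. sine n m * ?g m)"
      by (simp only: sum_subtractf sum_distrib_left)
    also have "\<dots> = \<kappa> / sine n m0 * (?w m0 * ?g m0 + (\<Sum>m\<in>?J. ?w m * ?g m))"
      unfolding compl by (simp add: distrib_left)
    also have "\<dots> = \<kappa> / sine n m0 * (\<Sum>m\<in>modes n e. ?w m * ?g m)"
      using m0 finite_modes[of n e] by (simp add: sum.remove[of _ m0])
    finally show "vec n (\<lambda>i. \<Sum>j\<in>{1..r}. \<kappa> * sine n ((i + 1 + 1) * \<sigma> j) * q j) $ i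
        = vec n (\<lambda>i. \<kappa> / sine n m0 * (\<Sum>m\<in>modes n e. ?w m * mode n m (int i + 2))) $ i"
      using i by simp
  qed simp
  moreover have "eigenvector (hankel n a b c d)
      (vec n (\<lambda>i. \<kappa> / sine n m0 * (\<Sum>m\<in>modes n e. ?w m * mode n m (int i + 2)))) \<mu>"
    using m0 k0 s0 sec by (intro hankel_eigenvector) auto
  ultimately show ?thesis by (simp only:)
qed

section \<open>Block products in one-based entries\<close>

lemma sum_vec_shift: "(\<Sum>i = 0..<r. h (Suc i)) = (\<Sum>j\<in>{1..r}. h j :: real)"
  by (rule sum.reindex_bij_witness[of _ "\<lambda>j. j - 1" Suc]) auto

lemma outer_carrier: "outer w \<in> carrier_mat (dim_vec w) (dim_vec w)"
  by (rule carrier_matI) (simp_all add: outer_def)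

lemma index_outer: "i < dim_vec w \<Longrightarrow> j < dim_vec w \<Longrightarrow> outer w $$ (i, j) = w $ i * w $ j"
  by (simp add: outer_def scalar_prod_def mat_of_cols_def)

lemma dim_vec1 [simp]: "dim_vec (vec1 r f) = r"
  by (simp add: vec1_def)

lemma vec1_carrier [simp]: "vec1 r f \<in> carrier_vec r"
  by (rule carrier_vecI) simp

lemma index_vec1 [simp]: "i < r \<Longrightarrow> vec1 r f $ i = f (Suc i)"
  by (simp add: vec1_def)

lemma rank_one_mult_vec1:
  "(1\<^sub>m r + outer (vec1 r u)) *\<^sub>v vec1 r p = vec1 r (\<lambda>j. p j + u j * (\<Sum>i\<in>{1..r}. u i * p i))"
proof -
  have O: "outer (vec1 r u) \<in> carrier_mat r r" using outer_carrier[of "vec1 r u"] by simp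
  have o: "outer (vec1 r u) *\<^sub>v vec1 r p = vec1 r (\<lambda>j. u j * (\<Sum>i\<in>{1..r}. u i * p i))"
  proof (rule eq_vecI)
    fix j assume "j < dim_vec (vec1 r (\<lambda>j. u j * (\<Sum>i\<in>{1..r}. u i * p i)))"
    then have j: "j < r" by simp
    have "(outer (vec1 r u) *\<^sub>v vec1 r p) $ j = (\<Sum>i = 0..<r. u (Suc j) * (u (Suc i) * p (Suc i)))"
      using j O by (simp add: scalar_prod_def index_outer mult.assoc)
    also have "\<dots> = (\<Sum>i\<in>{1..r}. u (Suc j) * (u i * p i))"
      by (rule sum_vec_shift)
    finally show "(outer (vec1 r u) *\<^sub>v vec1 r p) $ j
        = vec1 r (\<lambda>j. u j * (\<Sum>i\<in>{1..r}. u i * p i)) $ j"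
      using j by (simp add: sum_distrib_left)
  qed (use O in simp)
  have "(1\<^sub>m r + outer (vec1 r u)) *\<^sub>v vec1 r p = 1\<^sub>m r *\<^sub>v vec1 r p + outer (vec1 r u) *\<^sub>v vec1 r p"
    by (rule add_mult_distrib_mat_vec[OF one_carrier_mat O vec1_carrier])
  also have "\<dots> = vec1 r (\<lambda>j. p j + u j * (\<Sum>i\<in>{1..r}. u i * p i))"
    unfolding o by (rule eq_vecI) simp_all
  finally show ?thesis .
qed

lemma block_mat_mult_append:
  assumes "x \<in> carrier_vec (dim_vec u)" "y \<in> carrier_vec (dim_vec v)"
  shows "block_mat u v *\<^sub>v (x @\<^sub>v y)
    = ((1\<^sub>m (dim_vec u) + outer u) *\<^sub>v x) @\<^sub>v ((1\<^sub>m (dim_vec v) + outer v) *\<^sub>v y)"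
  using assms outer_carrier[of u] outer_carrier[of v]
  unfolding block_mat_def by (subst four_block_mat_mult_vec) auto

lemma mat1_mult_append:
  "mat1 n (r + s) F *\<^sub>v (vec1 r x @\<^sub>v vec1 s y)
    = vec1 n (\<lambda>k. (\<Sum>j\<in>{1..r}. F k j * x j) + (\<Sum>j\<in>{1..s}. F k (r + j) * y j))"
proof (rule eq_vecI)
  fix i assume "i < dim_vec (vec1 n (\<lambda>k. (\<Sum>j\<in>{1..r}. F k j * x j) + (\<Sum>j\<in>{1..s}. F k (r + j) * y j)))"
  then have i: "i < n" by simp
  let ?h = "\<lambda>j. F (i + 1) (j + 1) * (vec1 r x @\<^sub>v vec1 s y) $ j"
  have "(mat1 n (r + s) F *\<^sub>v (vec1 r x @\<^sub>v vec1 s y)) $ i = (\<Sum>j = 0..<r + s. ?h j)"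
    using i by (simp add: mat1_def scalar_prod_def)
  also have "\<dots> = (\<Sum>j = 0..<r. ?h j) + (\<Sum>j = r..<r + s. ?h j)"
    by (rule sum.atLeastLessThan_concat[symmetric]) simp_all
  also have "(\<Sum>j = 0..<r. ?h j) = (\<Sum>j = 0..<r. F (i + 1) (Suc j) * x (Suc j))"
    by (intro sum.cong refl) simp
  also have "\<dots> = (\<Sum>j\<in>{1..r}. F (i + 1) j * x j)" by (rule sum_vec_shift)
  also have "(\<Sum>j = r..<r + s. ?h j) = (\<Sum>j = 0..<s. ?h (j + r))"
    using sum.shift_bounds_nat_ivl[of ?h 0 r s] by (simp add: add.commute)
  also have "\<dots> = (\<Sum>j = 0..<s. F (i + 1) (r + Suc j) * y (Suc j))"
    by (intro sum.cong refl) (simp add: add.commute)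
  also have "\<dots> = (\<Sum>j\<in>{1..s}. F (i + 1) (r + j) * y j)" by (rule sum_vec_shift)
  finally show "(mat1 n (r + s) F *\<^sub>v (vec1 r x @\<^sub>v vec1 s y)) $ i
      = vec1 n (\<lambda>k. (\<Sum>j\<in>{1..r}. F k j * x j) + (\<Sum>j\<in>{1..s}. F k (r + j) * y j)) $ i"
    using i by (simp add: vec1_def)
qed (simp add: mat1_def)

lemma zero_vec1: "0\<^sub>v r = vec1 r (\<lambda>_. 0)"
  by (auto simp: vec1_def)

lemma mat1_mult_block_mat:
  assumes "n = r + s"
  shows "(mat1 n n F * block_mat (vec1 r u) (vec1 s v)) *\<^sub>v (vec1 r x @\<^sub>v vec1 s y)
    = vec1 n (\<lambda>k. (\<Sum>j\<in>{1..r}. F k j * (x j + u j * (\<Sum>i\<in>{1..r}. u i * x i)))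
        + (\<Sum>j\<in>{1..s}. F k (r + j) * (y j + v j * (\<Sum>i\<in>{1..s}. v i * y i))))"
proof -
  have "block_mat (vec1 r u) (vec1 s v) \<in> carrier_mat n n"
    using assms outer_carrier[of "vec1 r u"] outer_carrier[of "vec1 s v"] by (simp add: block_mat_def)
  moreover have "mat1 n n F \<in> carrier_mat n n" by (simp add: mat1_def)
  moreover have "vec1 r x @\<^sub>v vec1 s y \<in> carrier_vec n" using assms by simp
  ultimately have "(mat1 n n F * block_mat (vec1 r u) (vec1 s v)) *\<^sub>v (vec1 r x @\<^sub>v vec1 s y)
    = mat1 n n F *\<^sub>v (block_mat (vec1 r u) (vec1 s v) *\<^sub>v (vec1 r x @\<^sub>v vec1 s y))"
    by (intro assoc_mult_mat_vec)
  then show ?thesis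
    unfolding assms by (simp add: block_mat_mult_append rank_one_mult_vec1 mat1_mult_append)
qed

text \<open>Column \<open>l\<close> of the right factor has its only 1 in row
  \<open>\<pi> l\<close>, so multiplying by it picks column \<open>\<pi> l\<close> of the left
  factor.\<close>

lemma mat1_mult_selection:
  assumes "\<And>k l. k \<in> {1..n} \<Longrightarrow> l \<in> {1..n} \<Longrightarrow> B k l = (if k = \<pi> l then 1 else 0)"
    and "\<And>l. l \<in> {1..n} \<Longrightarrow> \<pi> l \<in> {1..n}"
  shows "mat1 n n A * mat1 n n B = mat1 n n (\<lambda>k l. A k (\<pi> l))"
proof (rule eq_matI)
  fix i j assume "i < dim_row (mat1 n n (\<lambda>k l. A k (\<pi> l)))" "j < dim_col (mat1 n n (\<lambda>k l. A k (\<pi> l)))"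
  then have ij: "i < n" "j < n" by (simp_all add: mat1_def)
  then have "(mat1 n n A * mat1 n n B) $$ (i, j) = (\<Sum>k = 0..<n. A (Suc i) (Suc k) * B (Suc k) (Suc j))"
    by (simp add: mat1_def scalar_prod_def)
  also have "\<dots> = (\<Sum>k\<in>{1..n}. A (Suc i) k * B k (Suc j))"
    by (rule sum_vec_shift)
  also have "\<dots> = (\<Sum>k\<in>{1..n}. if k = \<pi> (Suc j) then A (Suc i) k else 0)"
    using ij assms(1) by (intro sum.cong refl) simp
  also have "\<dots> = A (Suc i) (\<pi> (Suc j))"
    using ij assms(2)[of "Suc j"] by simp
  finally show "(mat1 n n A * mat1 n n B) $$ (i, j) = mat1 n n (\<lambda>k l. A k (\<pi> l)) $$ (i, j)"
    using ij by (simp add: mat1_def)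
qed (simp_all add: mat1_def)

section \<open>Sorting the columns of the sine matrices by parity\<close>

text \<open>The columns of \<open>R_even n\<close> carry the modes \<open>2, \<dots>, n + 1\<close>.
  The permutation puts the odd ones first, so the two blocks act on separate parity classes; the
  modes left out are 1 and \<open>n + 2\<close>.\<close>

lemma RP_even:
  assumes "even n"
  shows "R_even n * transpose_mat (P_even n) = mat1 n n (\<lambda>k l. sqrt (2 / real (n + 3)) *
    sine n ((k + 1) * (if l \<le> n div 2 then 2 * l + 1 else 2 * (l - n div 2))))"
proof -
  let ?\<pi> = "\<lambda>l. if l \<le> n div 2 then 2 * l else 2 * (l - n div 2) - 1"
  have "transpose_mat (P_even n) = mat1 n n (\<lambda>k l.
      if int k = 2 * int l \<or> int k = 2 * int l - int n - 1 then 1 else 0)"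
    by (auto simp: P_even_def mat1_def)
  moreover have "mat1 n n (\<lambda>k l. sqrt (2 / real (n + 3)) * sine n ((k + 1) * (l + 1)))
      * mat1 n n (\<lambda>k l. if int k = 2 * int l \<or> int k = 2 * int l - int n - 1 then 1 else 0)
    = mat1 n n (\<lambda>k l. sqrt (2 / real (n + 3)) * sine n ((k + 1) * (?\<pi> l + 1)))"
    using assms by (intro mat1_mult_selection) (auto elim!: evenE)
  moreover have "?\<pi> l + 1 = (if l \<le> n div 2 then 2 * l + 1 else 2 * (l - n div 2))" for l
    by auto
  ultimately show ?thesis unfolding R_even_def by (simp only:)
qed

text \<open>Here the last column of \<open>R_odd n\<close> carries mode \<open>n + 2\<close> in
  place of \<open>n + 1\<close>, so the modes left out are 1 and \<open>n + 1\<close>. The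
  exceptional clause of \<open>P_odd\<close> moves that column to the end of the odd block.\<close>

lemma RP_odd:
  assumes "odd n"
  shows "R_odd n * P_odd n = mat1 n n (\<lambda>k l. sqrt (2 / real (n + 3)) *
    sine n ((k + 1) * (if l \<le> (n + 1) div 2 then 2 * l + 1 else 2 * (l - (n + 1) div 2))))"
proof -
  let ?\<pi> = "\<lambda>l. if l < (n + 1) div 2 then 2 * l else if l = (n + 1) div 2 then n
    else 2 * (l - (n + 1) div 2) - 1"
  let ?R = "\<lambda>k l. sqrt (2 / real (n + 3)) *
     (if l < n then sine n ((k + 1) * (l + 1)) else sine n ((k + 1) * (n + 2)))"
  have "R_odd n * P_odd n = mat1 n n (\<lambda>k l. ?R k (?\<pi> l))"
    unfolding R_odd_def P_odd_def
  proof (rule mat1_mult_selection)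
    fix k l assume kl: "k \<in> {1..n}" "l \<in> {1..n}"
    obtain h where n: "n = 2 * h + 1" using assms by (rule oddE)
    have "(int k = 2 * int l \<or> int k = 2 * int l - int n - 2 \<or> k = n \<and> l = (n + 1) div 2) \<longleftrightarrow> k = ?\<pi> l"
      using kl unfolding n by simp presburger
    then show "(if int k = 2 * int l \<or> int k = 2 * int l - int n - 2 \<or> k = n \<and> l = (n + 1) div 2
      then 1 else 0 :: real) = (if k = ?\<pi> l then 1 else 0)" by (simp only:)
    show "?\<pi> l \<in> {1..n}" using kl unfolding n by auto
  qed
  also have "\<dots> = mat1 n n (\<lambda>k l. sqrt (2 / real (n + 3)) *
    sine n ((k + 1) * (if l \<le> (n + 1) div 2 then 2 * l + 1 else 2 * (l - (n + 1) div 2))))"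
    unfolding mat1_def
  proof (intro cong_mat refl, unfold prod.case)
    fix i j assume j: "j < n"
    obtain h where n: "n = 2 * h + 1" using assms by (rule oddE)
    \<comment> \<open>Only \<open>l = (n + 1) div 2\<close> selects column \<open>n\<close>, and
      there \<open>2 * l + 1 = n + 2\<close>, so the uniform formula absorbs the exception.\<close>
    have "(if ?\<pi> (j + 1) < n then ?\<pi> (j + 1) + 1 else n + 2)
        = (if j + 1 \<le> (n + 1) div 2 then 2 * (j + 1) + 1 else 2 * (j + 1 - (n + 1) div 2))"
      using j unfolding n by auto
    moreover have "?R k l = sqrt (2 / real (n + 3)) * sine n ((k + 1) * (if l < n then l + 1 else n + 2))" for k l
      by (cases "l < n") simp_all
    ultimately show "?R (i + 1) (?\<pi> (j + 1)) = sqrt (2 / real (n + 3)) * sine n ((i + 1 + 1) *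
        (if j + 1 \<le> (n + 1) div 2 then 2 * (j + 1) + 1 else 2 * (j + 1 - (n + 1) div 2)))"
      by (simp only:)
  qed
  finally show ?thesis .
qed

section \<open>Assembly of the four cases\<close>

text \<open>With a zero lower half the second sum in \<open>mat1_mult_block_mat\<close> vanishes,
  and the first is the vector of \<open>hankel_eigenvector_reduced\<close>. Both parities of
  \<open>n\<close> use this form.\<close>

lemma upper_block_eigenvector:
  assumes n: "n = r + s" and F: "\<And>k j. j \<in> {1..r} \<Longrightarrow> F k j = \<kappa> * sine n ((k + 1) * \<sigma> j)"
    and bij: "bij_betw \<sigma> {1..r} (modes n e - {m0})" and m0: "m0 \<in> modes n e"
    and inj: "inj_on (lam n a b c d) (modes n e)" and k0: "\<kappa> \<noteq> 0"
    and root: "(\<Prod>j\<in>{1..r}. \<mu> - lam n a b c d (\<sigma> j)) + (\<mu> - lam n a b c d m0) *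
      (\<Sum>j\<in>{1..r}. (sine n (\<sigma> j))\<^sup>2 / (sine n m0)\<^sup>2 *
         (\<Prod>m\<in>{1..r} - {j}. \<mu> - lam n a b c d (\<sigma> m))) = 0"
  shows "eigenvector (hankel n a b c d)
    ((mat1 n n F * block_mat (vec1 r (\<lambda>j. sine n (\<sigma> j) / sine n m0)) (vec1 s v)) *\<^sub>v
      (vec1 r (\<lambda>j. sine n (\<sigma> j) / ((\<mu> - lam n a b c d (\<sigma> j)) * sine n m0)) @\<^sub>v 0\<^sub>v s)) \<mu>"
  using hankel_eigenvector_reduced[OF bij m0 inj k0 root]
  unfolding zero_vec1 mat1_mult_block_mat[OF n] using F by (simp del: One_nat_def)

lemma lower_block_eigenvector:
  assumes n: "n = r + s" and F: "\<And>k j. j \<in> {1..s} \<Longrightarrow> F k (r + j) = \<kappa> * sine n ((k + 1) * \<sigma> j)"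
    and bij: "bij_betw \<sigma> {1..s} (modes n e - {m0})" and m0: "m0 \<in> modes n e"
    and inj: "inj_on (lam n a b c d) (modes n e)" and k0: "\<kappa> \<noteq> 0"
    and root: "(\<Prod>j\<in>{1..s}. \<mu> - lam n a b c d (\<sigma> j)) + (\<mu> - lam n a b c d m0) *
      (\<Sum>j\<in>{1..s}. (sine n (\<sigma> j))\<^sup>2 / (sine n m0)\<^sup>2 *
         (\<Prod>m\<in>{1..s} - {j}. \<mu> - lam n a b c d (\<sigma> m))) = 0"
  shows "eigenvector (hankel n a b c d)
    ((mat1 n n F * block_mat (vec1 r u) (vec1 s (\<lambda>j. sine n (\<sigma> j) / sine n m0))) *\<^sub>v
      (0\<^sub>v r @\<^sub>v vec1 s (\<lambda>j. sine n (\<sigma> j) / ((\<mu> - lam n a b c d (\<sigma> j)) * sine n m0)))) \<mu>"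
  using hankel_eigenvector_reduced[OF bij m0 inj k0 root]
  unfolding zero_vec1 mat1_mult_block_mat[OF n] using F by (simp del: One_nat_def)

text \<open>For even \<open>n\<close> the eliminated even mode is \<open>n + 2\<close>, while
  \<open>v_even\<close> and \<open>g_even\<close> are normalised by \<open>sine n 1\<close>; this
  identity reconciles them.\<close>

lemma sine_last: "sine n (n + 2) = sine n 1"
  using mode_reflect[of n 1 1] by (simp add: mode_def sine_def add.commute)

lemma bij_odd_modes:
  assumes "r = (n + 1) div 2"
  shows "bij_betw (\<lambda>j. 2 * j + 1) {1..r} (modes n False - {1})"
  by (rule bij_betw_byWitness[where f' = "\<lambda>m. (m - 1) div 2"])
     (use assms in \<open>auto simp: modes_def elim!: oddE\<close>)

text \<open>The removed mode is the largest even number up to \<open>n + 2\<close>, namely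
  \<open>n + 2\<close> for even \<open>n\<close> and \<open>n + 1\<close> for odd \<open>n\<close>,
  so one statement serves both parities.\<close>

lemma bij_even_modes:
  assumes "r = n div 2"
  shows "bij_betw (\<lambda>j. 2 * j) {1..r} (modes n True - {2 * (n div 2 + 1)})"
proof (rule bij_betw_byWitness[where f' = "\<lambda>m. m div 2"])
  have "m div 2 \<in> {1..r}" if "m \<in> modes n True - {2 * (n div 2 + 1)}" for m
  proof -
    from that obtain h where "m = 2 * h" "1 \<le> m" "m \<le> n + 2" "h \<noteq> n div 2 + 1"
      by (auto simp: modes_def elim!: evenE)
    then show ?thesis unfolding assms by simp
  qed
  then show "(\<lambda>m. m div 2) ` (modes n True - {2 * (n div 2 + 1)}) \<subseteq> {1..r}" by blast
qed (use assms in \<open>auto simp: modes_def\<close>)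

theorem theorem2:
  fixes n :: nat and a b c d :: real
  assumes "n \<ge> 1"
  shows
    "(even n \<longrightarrow>
       (\<forall>\<mu> :: nat \<Rightarrow> real.
          \<mu> ` {1..n div 2} = {t. poly (f_even n a b c d) t = 0} \<and>
          inj_on (lam n a b c d) {k \<in> {1..n + 1}. odd k} \<longrightarrow>
          (\<forall>k \<in> {1..n div 2}.
             eigenvector (hankel n a b c d)
               ((R_even n * transpose_mat (P_even n) * block_mat (u_even n) (v_even n)) *\<^sub>v
                (vec1 (n div 2) (\<lambda>j. sine n (2 * j + 1) /
                     ((\<mu> k - lam n a b c d (2 * j + 1)) * sine n 1))
                 @\<^sub>v 0\<^sub>v (n div 2)))
               (\<mu> k))) \<and>
       (\<forall>\<nu> :: nat \<Rightarrow> real.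
          \<nu> ` {1..n div 2} = {t. poly (g_even n a b c d) t = 0} \<and>
          inj_on (lam n a b c d) {k \<in> {2..n + 2}. even k} \<longrightarrow>
          (\<forall>k \<in> {1..n div 2}.
             eigenvector (hankel n a b c d)
               ((R_even n * transpose_mat (P_even n) * block_mat (u_even n) (v_even n)) *\<^sub>v
                (0\<^sub>v (n div 2) @\<^sub>v
                 vec1 (n div 2) (\<lambda>j. sine n (2 * j) /
                     ((\<nu> k - lam n a b c d (2 * j)) * sine n 1))))
               (\<nu> k)))) \<and>
     (odd n \<longrightarrow>
       (\<forall>\<mu> :: nat \<Rightarrow> real.
          \<mu> ` {1..(n + 1) div 2} = {t. poly (f_odd n a b c d) t = 0} \<and>
          inj_on (lam n a b c d) {k \<in> {1..n + 2}. odd k} \<longrightarrow>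
          (\<forall>k \<in> {1..(n + 1) div 2}.
             eigenvector (hankel n a b c d)
               ((R_odd n * P_odd n * block_mat (u_odd n) (v_odd n)) *\<^sub>v
                (vec1 ((n + 1) div 2) (\<lambda>j. sine n (2 * j + 1) /
                     ((\<mu> k - lam n a b c d (2 * j + 1)) * sine n 1))
                 @\<^sub>v 0\<^sub>v ((n - 1) div 2)))
               (\<mu> k))) \<and>
       (\<forall>\<nu> :: nat \<Rightarrow> real.
          \<nu> ` {1..(n - 1) div 2} = {t. poly (g_odd n a b c d) t = 0} \<and>
          inj_on (lam n a b c d) {k \<in> {2..n + 1}. even k} \<longrightarrow>
          (\<forall>k \<in> {1..(n - 1) div 2}.
             eigenvector (hankel n a b c d)
               ((R_odd n * P_odd n * block_mat (u_odd n) (v_odd n)) *\<^sub>v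
                (0\<^sub>v ((n + 1) div 2) @\<^sub>v
                 vec1 ((n - 1) div 2) (\<lambda>j. sine n (2 * j) /
                     ((\<nu> k - lam n a b c d (2 * j)) * sine n (n + 1)))))
               (\<nu> k))))"
proof -
  let ?\<kappa> = "sqrt (2 / real (n + 3))" and ?L = "lam n a b c d"
  have k0: "?\<kappa> \<noteq> 0" by simp
  have one: "1 \<in> modes n False" by (simp add: modes_def)
  have even_upper: "eigenvector (hankel n a b c d)
      ((R_even n * transpose_mat (P_even n) * block_mat (u_even n) (v_even n)) *\<^sub>v
        (vec1 (n div 2) (\<lambda>j. sine n (2 * j + 1) / ((t - ?L (2 * j + 1)) * sine n 1)) @\<^sub>v 0\<^sub>v (n div 2))) t"
    if n: "even n" and root: "poly (f_even n a b c d) t = 0" and inj: "inj_on ?L {k \<in> {1..n + 1}. odd k}" for t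
  proof -
    have "modes n False = {k \<in> {1..n + 1}. odd k}" using n by (auto simp: modes_def le_Suc_eq)
    with inj have inj': "inj_on ?L (modes n False)" by simp
    have split: "n = n div 2 + n div 2" using n by (auto elim!: evenE)
    show ?thesis
      unfolding RP_even[OF n] u_even_def v_even_def
      by (rule upper_block_eigenvector[where \<sigma> = "\<lambda>j. 2 * j + 1" and \<kappa> = ?\<kappa>, OF split _ bij_odd_modes one inj' k0])
         (use n root in \<open>simp_all add: f_even_def poly_prod poly_sum left_diff_distrib del: One_nat_def\<close>)
  qed
  have even_lower: "eigenvector (hankel n a b c d)
      ((R_even n * transpose_mat (P_even n) * block_mat (u_even n) (v_even n)) *\<^sub>v
        (0\<^sub>v (n div 2) @\<^sub>v vec1 (n div 2) (\<lambda>j. sine n (2 * j) / ((t - ?L (2 * j)) * sine n 1)))) t"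
    if n: "even n" and root: "poly (g_even n a b c d) t = 0" and inj: "inj_on ?L {k \<in> {2..n + 2}. even k}" for t
  proof -
    have "modes n True = {k \<in> {2..n + 2}. even k}" by (auto simp: modes_def elim!: evenE)
    with inj have inj': "inj_on ?L (modes n True)" by simp
    have last: "n + 2 \<in> modes n True" using n by (simp add: modes_def)
    have bij: "bij_betw (\<lambda>j. 2 * j) {1..n div 2} (modes n True - {n + 2})"
      using bij_even_modes[OF refl, of n] n by simp
    have split: "n = n div 2 + n div 2" using n by (auto elim!: evenE)
    show ?thesis
      unfolding RP_even[OF n] u_even_def v_even_def sine_last[symmetric]
      by (rule lower_block_eigenvector[where \<sigma> = "\<lambda>j. 2 * j" and \<kappa> = ?\<kappa>, OF split _ bij last inj' k0])
         (use n root[unfolded g_even_def sine_last[symmetric]] in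
          \<open>simp_all add: poly_prod poly_sum left_diff_distrib del: One_nat_def\<close>)
  qed
  have odd_upper: "eigenvector (hankel n a b c d)
      ((R_odd n * P_odd n * block_mat (u_odd n) (v_odd n)) *\<^sub>v
        (vec1 ((n + 1) div 2) (\<lambda>j. sine n (2 * j + 1) / ((t - ?L (2 * j + 1)) * sine n 1))
          @\<^sub>v 0\<^sub>v ((n - 1) div 2))) t"
    if n: "odd n" and root: "poly (f_odd n a b c d) t = 0" and inj: "inj_on ?L {k \<in> {1..n + 2}. odd k}" for t
  proof -
    have "modes n False = {k \<in> {1..n + 2}. odd k}" by (auto simp: modes_def)
    with inj have inj': "inj_on ?L (modes n False)" by simp
    have split: "n = (n + 1) div 2 + (n - 1) div 2" using n by (auto elim!: oddE)
    show ?thesis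
      unfolding RP_odd[OF n] u_odd_def v_odd_def
      by (rule upper_block_eigenvector[where \<sigma> = "\<lambda>j. 2 * j + 1" and \<kappa> = ?\<kappa>,
            OF split _ bij_odd_modes one inj' k0])
         (use n root in \<open>simp_all add: f_odd_def poly_prod poly_sum left_diff_distrib del: One_nat_def\<close>)
  qed
  have odd_lower: "eigenvector (hankel n a b c d)
      ((R_odd n * P_odd n * block_mat (u_odd n) (v_odd n)) *\<^sub>v
        (0\<^sub>v ((n + 1) div 2) @\<^sub>v
         vec1 ((n - 1) div 2) (\<lambda>j. sine n (2 * j) / ((t - ?L (2 * j)) * sine n (n + 1))))) t"
    if n: "odd n" and root: "poly (g_odd n a b c d) t = 0" and inj: "inj_on ?L {k \<in> {2..n + 1}. even k}" for t
  proof -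
    have "modes n True = {k \<in> {2..n + 1}. even k}"
      using n by (auto simp: modes_def le_Suc_eq elim!: evenE; presburger)
    with inj have inj': "inj_on ?L (modes n True)" by simp
    have split: "n = (n + 1) div 2 + (n - 1) div 2" using n by (auto elim!: oddE)
    have last: "n + 1 \<in> modes n True" using n by (simp add: modes_def)
    have "2 * (n div 2 + 1) = n + 1" "(n - 1) div 2 = n div 2" using n by (auto elim!: oddE)
    then have bij: "bij_betw (\<lambda>j. 2 * j) {1..(n - 1) div 2} (modes n True - {n + 1})"
      using bij_even_modes[of "(n - 1) div 2" n] by simp
    show ?thesis
      unfolding RP_odd[OF n] u_odd_def v_odd_def
      by (rule lower_block_eigenvector[where \<sigma> = "\<lambda>j. 2 * j" and \<kappa> = ?\<kappa>, OF split _ bij last inj' k0])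
         (use n root in \<open>simp_all add: g_odd_def poly_prod poly_sum left_diff_distrib del: One_nat_def\<close>)
  qed
  \<comment> \<open>Each \<open>\<mu> k\<close> or \<open>\<nu> k\<close> with \<open>k\<close> in
    range lies in the assumed zero set, hence is a root to which the matching case applies.\<close>
  show ?thesis
    using even_upper even_lower odd_upper odd_lower by blast
qed

end
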